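(* Let $K\subset\mathbb{R}^m$ be a nonempty closed convex set, $F:\mathbb{R}^m\to\mathbb{R}^m$ be a continuous mapping and $L\subset\mathbb{R}^m$ be a cone. Let $x^0\in\mathbb{R}^m$ and consider the sequence $\{x^n\}_{n\in\mathbb{N}}$ defined by $x^{n+1}=P_K(x^n-F(x^n))$ for $n\in\mathbb{N}$. Let $I$ denote the identity mapping of $\mathbb{R}^m$. Suppose that the mappings $P_K$ and $I-F$ are $L$-isotone and $x^0\le_L x^1$. Let $$\Omega=\{x\in K\cap(x^0+L):F(x)\in L\},\qquad \Gamma=\{x\in K\cap(x^0+L):P_K(x-F(x))\le_L x\}.$$ Consider the following assertions: (i) $\Omega\ne\varnothing$; (ii) $\Gamma\ne\varnothing$; (iii) the sequence $\{x^n\}_{n\in\mathbb{N}}$ is convergent and its limit $x^*$ is a solution of the variational inequality $VI(F,K)$; moreover, $x^*$ is the $L$-least element of $\Gamma$. Then $\Omega\subset\Gamma$ and (i)$\implies$(ii)$\implies$(iii).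
   Context: $\mathbb{N}$ is the set of nonnegative integers; $m$ is a positive integer and $\mathbb{R}^m$ carries the canonical inner product $x^\top y$ and Euclidean norm. A closed set $L\subset\mathbb{R}^m$ is called a cone if $L\cap(-L)=\{0\}$ and $\lambda x+\mu y\in L$ whenever $\lambda,\mu\ge0$ and $x,y\in L$. The partial order defined by $L$ is $x\le_L y\iff y-x\in L$. A mapping $T:\mathbb{R}^m\to\mathbb{R}^m$ is $L$-isotone if $x\le_L y$ implies $T(x)\le_L T(y)$. An element $y\in\Gamma$ is the $L$-least element of $\Gamma$ if $y\le_L x$ for all $x\in\Gamma$. $P_K$ denotes the metric (nearest-point) projection onto the closed convex set $K$. A solution of $VI(F,K)$ is a point $x^*\in K$ such that $(y-x^* )^\top F(x^* )\ge0$ for all $y\in K$. *)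

theory Defs
  imports "HOL-Analysis.Analysis"
begin

text \<open>
  Here a cone is closed, convex and pointed, unlike in the library notions \<^const>\<open>cone\<close> and
  \<^const>\<open>convex_cone\<close>. Nonemptiness is implied by the condition on the intersection.
\<close>

definition order_cone :: "'a::real_normed_vector set \<Rightarrow> bool" where
  "order_cone L \<longleftrightarrow> closed L \<and> L \<inter> uminus ` L = {0} \<and>
     (\<forall>x\<in>L. \<forall>y\<in>L. \<forall>a\<ge>0. \<forall>b\<ge>0. a *\<^sub>R x + b *\<^sub>R y \<in> L)"

definition cone_le :: "'a::real_vector set \<Rightarrow> 'a \<Rightarrow> 'a \<Rightarrow> bool" where
  "cone_le L x y \<longleftrightarrow> y - x \<in> L"

definition cone_isotone :: "'a::real_vector set \<Rightarrow> ('a \<Rightarrow> 'a) \<Rightarrow> bool" where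
  "cone_isotone L T \<longleftrightarrow> monotone (cone_le L) (cone_le L) T"

definition cone_least :: "'a::real_vector set \<Rightarrow> 'a set \<Rightarrow> 'a \<Rightarrow> bool" where
  "cone_least L G y \<longleftrightarrow> y \<in> G \<and> (\<forall>x\<in>G. cone_le L y x)"

definition VI_solution :: "('a::real_inner \<Rightarrow> 'a) \<Rightarrow> 'a set \<Rightarrow> 'a \<Rightarrow> bool" where
  "VI_solution F K z \<longleftrightarrow> z \<in> K \<and> (\<forall>y\<in>K. (y - z) \<bullet> F z \<ge> 0)"

end

theory Submission
  imports Defs
begin

text \<open>
  The iterates of \<open>T z = P\<^sub>K (z - F z)\<close> increase with respect to \<open>L\<close>, and every element of \<open>\<Gamma>\<close> bounds
  them from above. In finite dimension a closed pointed convex cone is normal, by compactness of its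
  unit vectors, so an increasing order-bounded sequence is norm bounded; a cluster point is an upper
  bound of the sequence, and normality forces the whole sequence to converge to it. The limit is a
  fixed point of \<open>T\<close>, that is, a solution of the variational inequality, and it stays below \<open>\<Gamma>\<close>.
\<close>

lemma order_cone_zero: "order_cone L \<Longrightarrow> 0 \<in> L"
  unfolding order_cone_def by blast

lemma order_cone_scaleR: "order_cone L \<Longrightarrow> x \<in> L \<Longrightarrow> a \<ge> 0 \<Longrightarrow> a *\<^sub>R x \<in> L"
  unfolding order_cone_def by (metis add.right_neutral order_refl scaleR_zero_left)

lemma order_cone_add: "order_cone L \<Longrightarrow> x \<in> L \<Longrightarrow> y \<in> L \<Longrightarrow> x + y \<in> L"
  unfolding order_cone_def by (metis scaleR_one zero_le_one)

lemma order_cone_pointed: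
  assumes "order_cone L" "x \<in> L" "- x \<in> L"
  shows "x = 0"
proof -
  have "x \<in> uminus ` L"
    using assms(3) by (metis image_eqI minus_minus)
  then show ?thesis
    using assms unfolding order_cone_def by blast
qed

lemma cone_le_refl: "order_cone L \<Longrightarrow> cone_le L x x"
  by (simp add: cone_le_def order_cone_zero)

lemma cone_le_trans: "order_cone L \<Longrightarrow> cone_le L x y \<Longrightarrow> cone_le L y z \<Longrightarrow> cone_le L x z"
  unfolding cone_le_def using order_cone_add[of L "y - x" "z - y"] by simp

lemma cone_isotoneD: "cone_isotone L T \<Longrightarrow> cone_le L x y \<Longrightarrow> cone_le L (T x) (T y)"
  unfolding cone_isotone_def by (rule monotoneD)

lemma mem_plus_image_iff_cone_le: "z \<in> (+) x ` L \<longleftrightarrow> cone_le L x z"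
  unfolding cone_le_def by (force simp: image_iff)

text \<open>The bound is required only eventually, because the terms of a subsequence dominate a
  fixed term of an increasing sequence only from some index on.\<close>

lemma cone_le_lim_right:
  assumes "order_cone L" "X \<longlonglongrightarrow> l" "\<forall>\<^sub>F n in sequentially. cone_le L a (X n)"
  shows "cone_le L a l"
proof -
  have "(\<lambda>n. X n - a) \<longlonglongrightarrow> l - a"
    by (intro tendsto_intros assms)
  moreover have "closed L"
    using assms(1) by (simp add: order_cone_def)
  ultimately show ?thesis
    using assms(3) unfolding cone_le_def
    by (metis Lim_in_closed_set trivial_limit_sequentially)
qed

lemma cone_le_lim_left:
  assumes "order_cone L" "X \<longlonglongrightarrow> l" "\<And>n. cone_le L (X n) b"
  shows "cone_le L l b"
proof -
  have "(\<lambda>n. b - X n) \<longlonglongrightarrow> b - l"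
    by (intro tendsto_intros assms)
  moreover have "closed L"
    using assms(1) by (simp add: order_cone_def)
  ultimately show ?thesis
    using assms(3) unfolding cone_le_def by (metis closed_sequentially)
qed

text \<open>The sums of a unit vector of \<open>L\<close> and a vector of \<open>L\<close> form a
  closed set (compact plus closed), and pointedness keeps 0 out of it. Its distance from 0 gives
  \<open>d\<close>, and homogeneity extends the bound to all of \<open>L\<close>.\<close>

lemma order_cone_normal:
  fixes L :: "'a::euclidean_space set"
  assumes L: "order_cone L"
  obtains d where "d > 0" "\<And>x y. x \<in> L \<Longrightarrow> y - x \<in> L \<Longrightarrow> d * norm x \<le> norm y"
proof -
  let ?A = "\<Union>u \<in> L \<inter> sphere 0 1. \<Union>v \<in> L. {u + v}"
  have "closed L"
    using L by (simp add: order_cone_def)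
  then have "closed ?A"
    by (intro compact_closed_sums closed_Int_compact) auto
  moreover have "0 \<notin> ?A"
  proof
    assume "0 \<in> ?A"
    then obtain u v where uv: "u \<in> L" "norm u = 1" "v \<in> L" "0 = u + v"
      by auto
    then have "- u \<in> L"
      by (metis add_eq_0_iff)
    with uv show False
      using order_cone_pointed[OF L, of u] by simp
  qed
  ultimately have "\<exists>d>0. \<forall>w\<in>?A. d \<le> dist 0 w"
    by (rule separate_point_closed)
  then obtain d where d: "d > 0" "\<forall>w\<in>?A. d \<le> dist 0 w"
    by metis
  have "d * norm x \<le> norm y" if xy: "x \<in> L" "y - x \<in> L" for x y
  proof (cases "x = 0")
    case False
    let ?c = "inverse (norm x)"
    have "?c *\<^sub>R x \<in> L \<inter> sphere 0 1" "?c *\<^sub>R (y - x) \<in> L"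
      using xy False order_cone_scaleR[OF L] by auto
    \<comment> \<open>Normalizing \<open>x\<close> turns \<open>y = x + (y - x)\<close> into an
      element of \<open>?A\<close>, namely \<open>y\<close> divided by
      \<open>norm x\<close>.\<close>
    then have "?c *\<^sub>R x + ?c *\<^sub>R (y - x) \<in> ?A"
      by blast
    then have "d \<le> norm (?c *\<^sub>R x + ?c *\<^sub>R (y - x))"
      using bspec[OF d(2)] by (metis dist_0_norm)
    also have "\<dots> = norm y / norm x"
      by (simp add: algebra_simps divide_inverse)
    finally show ?thesis
      using False by (simp add: field_simps)
  qed simp
  with d(1) show thesis
    by (rule that)
qed

lemma cone_increasing_bounded_convergent:
  fixes X :: "nat \<Rightarrow> 'a::euclidean_space"
  assumes L: "order_cone L"
    and inc: "\<And>n. cone_le L (X n) (X (Suc n))"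
    and bdd: "\<And>n. cone_le L (X n) b"
  shows "convergent X"
proof -
  obtain d where d: "d > 0" "\<And>x y. x \<in> L \<Longrightarrow> y - x \<in> L \<Longrightarrow> d * norm x \<le> norm y"
    using order_cone_normal[OF L] by blast
  have mono: "cone_le L (X m) (X n)" if "m \<le> n" for m n
    using that
    by (induction n rule: dec_induct) (auto intro: cone_le_refl cone_le_trans L inc)
  \<comment> \<open>Normality is applied to \<open>b - X n\<close>, which lies between 0 and
    \<open>b - X 0\<close> in the cone order.\<close>
  have "norm (b - X n) \<le> norm (b - X 0) / d" for n
    using d(2)[of "b - X n" "b - X 0"] bdd[of n] mono[of 0 n] d(1)
    by (simp add: cone_le_def field_simps)
  then have "bounded (range X)"
    unfolding bounded_def dist_norm by blast
  then obtain l r where r: "strict_mono r" "(X \<circ> r) \<longlonglongrightarrow> l"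
    using bounded_imp_convergent_subsequence by blast
  have up: "cone_le L (X n) l" for n
  proof (rule cone_le_lim_right[OF L r(2)])
    show "\<forall>\<^sub>F k in sequentially. cone_le L (X n) ((X \<circ> r) k)"
      using eventually_ge_at_top[of n]
      by eventually_elim (simp add: mono order_trans[OF _ seq_suble[OF r(1)]])
  qed
  have "X \<longlonglongrightarrow> l"
  proof (rule LIMSEQ_I)
    fix e :: real assume "e > 0"
    \<comment> \<open>A single term within \<open>d * e\<close> of \<open>l\<close> suffices: every
      later \<open>X n\<close> lies between \<open>X (r k)\<close> and \<open>l\<close>, so
      normality bounds its distance to \<open>l\<close> by that of \<open>X (r k)\<close> up to the
      factor \<open>1 / d\<close>.\<close>
    then obtain k where k: "norm (X (r k) - l) < d * e"
      using LIMSEQ_D[OF r(2), of "d * e"] d(1) by (auto simp: o_def)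
    have "norm (X n - l) < e" if "n \<ge> r k" for n
    proof -
      have "d * norm (l - X n) \<le> norm (l - X (r k))"
        using d(2)[of "l - X n" "l - X (r k)"] up[of n] mono[OF that]
        by (simp add: cone_le_def)
      also have "\<dots> < d * e"
        using k by (simp add: norm_minus_commute)
      finally show ?thesis
        using d(1) by (simp add: norm_minus_commute)
    qed
    then show "\<exists>N. \<forall>n\<ge>N. norm (X n - l) < e"
      by blast
  qed
  then show ?thesis
    by (rule convergentI)
qed

text \<open>The obtuse angle property of the projection of \<open>u = z - F z\<close> gives
  \<open>(u - z) \<bullet> (y - z) \<le> 0\<close> on \<open>K\<close>, and here
  \<open>u - z = - F z\<close>.\<close>

lemma VI_solution_if_closest_point_fixed:
  fixes K :: "'a::euclidean_space set"
  assumes "K \<noteq> {}" "closed K" "convex K" and fix_z: "closest_point K (z - F z) = z"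
  shows "VI_solution F K z"
  unfolding VI_solution_def
proof (intro conjI ballI)
  show "z \<in> K"
    using closest_point_in_set[of K "z - F z"] assms by simp
  fix y assume "y \<in> K"
  then show "(y - z) \<bullet> F z \<ge> 0"
    using closest_point_dot[of K y "z - F z"] assms
    by (simp add: inner_commute)
qed

theorem proposition1:
  fixes K L \<Omega> \<Gamma> :: "(real ^ 'm) set"
    and F :: "real ^ 'm \<Rightarrow> real ^ 'm"
    and x :: "nat \<Rightarrow> real ^ 'm"
  assumes "K \<noteq> {}" and "closed K" and "convex K"
    and "continuous_on UNIV F"
    and "order_cone L"
    and "\<And>n. x (Suc n) = closest_point K (x n - F (x n))"
    and "cone_isotone L (closest_point K)"
    and "cone_isotone L (\<lambda>z. z - F z)"
    and "cone_le L (x 0) (x 1)"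
    and "\<Omega> = {z \<in> K \<inter> (+) (x 0) ` L. F z \<in> L}"
    and "\<Gamma> = {z \<in> K \<inter> (+) (x 0) ` L. cone_le L (closest_point K (z - F z)) z}"
  shows "\<Omega> \<subseteq> \<Gamma> \<and>
    (\<Omega> \<noteq> {} \<longrightarrow> \<Gamma> \<noteq> {}) \<and>
    (\<Gamma> \<noteq> {} \<longrightarrow>
      (\<exists>xs. x \<longlonglongrightarrow> xs \<and> VI_solution F K xs \<and> cone_least L \<Gamma> xs))"
proof (intro conjI impI)
  note ne = assms(1) and clK = assms(2) and cvK = assms(3) and F = assms(4) and L = assms(5)
    and x_Suc = assms(6) and P_iso = assms(7) and IF_iso = assms(8) and x01 = assms(9)
    and \<Omega> = assms(10) and \<Gamma> = assms(11)
  let ?T = "\<lambda>z. closest_point K (z - F z)"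
  have T_iso: "cone_le L (?T a) (?T b)" if "cone_le L a b" for a b
    using cone_isotoneD[OF P_iso cone_isotoneD[OF IF_iso that]] .
  have T_cont: "continuous_on UNIV ?T"
    by (rule continuous_on_compose2[OF continuous_on_closest_point[OF cvK clK ne, of UNIV]])
      (auto intro: continuous_intros F)
  show sub: "\<Omega> \<subseteq> \<Gamma>"
  proof
    fix z assume z: "z \<in> \<Omega>"
    \<comment> \<open>Since \<open>F z\<close> is in \<open>L\<close>, \<open>z - F z\<close> is
      below \<open>z\<close>; projecting keeps the order and fixes \<open>z\<close>, which lies in
      \<open>K\<close>.\<close>
    then have "cone_le L (closest_point K (z - F z)) (closest_point K z)"
      by (intro cone_isotoneD[OF P_iso]) (simp add: \<Omega> cone_le_def)
    then show "z \<in> \<Gamma>"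
      using z by (simp add: \<Omega> \<Gamma> closest_point_self)
  qed
  then show "\<Gamma> \<noteq> {}" if "\<Omega> \<noteq> {}"
    using that by blast
  have inc: "cone_le L (x n) (x (Suc n))" for n
    using x01 by (induction n) (auto simp: x_Suc intro: T_iso)
  have le_\<Gamma>: "cone_le L (x n) z" if "z \<in> \<Gamma>" for n z
  proof (induction n)
    case 0
    show ?case
      using that by (simp add: \<Gamma> mem_plus_image_iff_cone_le)
  next
    case (Suc n)
    \<comment> \<open>Elements of \<open>\<Gamma>\<close> are supersolutions, so
      \<open>x (Suc n) = ?T (x n)\<close> is below \<open>?T z\<close>, hence below
      \<open>z\<close>.\<close>
    have "cone_le L (?T z) z"
      using that by (simp add: \<Gamma>)
    then show ?case
      using cone_le_trans[OF L T_iso[OF Suc]] by (simp add: x_Suc)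
  qed
  assume "\<Gamma> \<noteq> {}"
  then obtain b where "b \<in> \<Gamma>"
    by blast
  then have "convergent x"
    by (intro cone_increasing_bounded_convergent[OF L, of x b] inc le_\<Gamma>)
  then obtain xs where lim: "x \<longlonglongrightarrow> xs"
    by (auto simp: convergent_def)
  \<comment> \<open>The shifted sequence tends to \<open>?T xs\<close> by continuity and to
    \<open>xs\<close> as a tail of \<open>x\<close>.\<close>
  have "(\<lambda>n. x (Suc n)) \<longlonglongrightarrow> ?T xs"
    unfolding x_Suc by (rule continuous_on_tendsto_compose[OF T_cont lim]) auto
  then have fixed: "?T xs = xs"
    using LIMSEQ_Suc[OF lim] by (rule LIMSEQ_unique)
  have VI: "VI_solution F K xs"
    by (intro VI_solution_if_closest_point_fixed ne clK cvK fixed)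
  \<comment> \<open>This places the limit in the translate of \<open>L\<close> by
    \<open>x 0\<close>, as membership in \<open>\<Gamma>\<close> demands.\<close>
  have "cone_le L (x 0) (x n)" for n
    by (induction n) (auto intro: cone_le_refl cone_le_trans L inc)
  then have "cone_le L (x 0) xs"
    by (intro cone_le_lim_right[OF L lim]) auto
  then have "xs \<in> \<Gamma>"
    using VI cone_le_refl[OF L]
    by (simp add: \<Gamma> mem_plus_image_iff_cone_le fixed VI_solution_def)
  moreover have "cone_le L xs z" if "z \<in> \<Gamma>" for z
    using cone_le_lim_left[OF L lim le_\<Gamma>[OF that]] .
  ultimately have "cone_least L \<Gamma> xs"
    by (simp add: cone_least_def)
  with lim VI show "\<exists>xs. x \<longlonglongrightarrow> xs \<and> VI_solution F K xs \<and> cone_least L \<Gamma> xs"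
    by blast
qed

end
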